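(* Let $\lambda\in\mathbb R$ and let $\gamma(t)=\Psi(u(t),v(t))$, $t\in[a,b]$, be a smooth non-degenerate curve in $(\mathbb S_1^2)_{xy}^+=\{(x,y,z)\in\mathbb S_1^2:z>0\}$ with $\sinh(u)+\lambda\neq0$ along $\gamma$. Then $\gamma$ is a catenary with respect to the plane $\Pi_{xy}=\{z=0\}$ (with Lagrange multiplier $\lambda$) if and only if its curvature $\kappa$ satisfies $$\kappa=-\frac{v'\cosh(u)^2}{(\sinh(u)+\lambda)\,|\gamma'|}.$$
   Context: $\mathbb L^3$ is $\mathbb R^3$ with the metric $\langle\,,\rangle=(dx)^2+(dy)^2-(dz)^2$, and $\mathbb S_1^2=\{(x,y,z):x^2+y^2-z^2=1\}$ with the induced metric, parametrized by $\Psi\colon\mathbb R^2\to\mathbb S_1^2$, $\Psi(u,v)=(\cosh(u)\cos v,\cosh(u)\sin v,\sinh(u))$. A curve $\gamma$ is non-degenerate if it is spacelike ($\langle\gamma',\gamma'\rangle>0$ everywhere; $\epsilon=1$) or timelike ($\langle\gamma',\gamma'\rangle<0$ everywhere; $\epsilon=-1$). For $\gamma(t)=\Psi(u(t),v(t))$ one has $|\gamma'|=\sqrt{\epsilon\langle\gamma',\gamma'\rangle}=\sqrt{\epsilon(v'^2\cosh(u)^2-u'^2)}$. The (geodesic) curvature of $\gamma$ in $\mathbb S_1^2$ is $\kappa=\epsilon\,\dfrac{\langle\gamma'',\gamma'\times\xi(\gamma)\rangle}{|\gamma'|^3}=\epsilon\,\dfrac{\det(\gamma,\gamma',\gamma'')}{|\gamma'|^3}$,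 where $\xi(p)=-p$ and $\times$ is the Lorentzian cross product, $\langle a\times b,c\rangle=\det(a,b,c)$. The distance of a point $(x,y,z)\in(\mathbb S_1^2)_{xy}^+$ to $\Pi_{xy}$ is $z$. A catenary with respect to $\Pi_{xy}$ with Lagrange multiplier $\lambda$ is a critical point, among curves in $(\mathbb S_1^2)_{xy}^+$ with the same endpoints, of $$\mathcal E_{xy}[\gamma]=\int_a^b(\sinh(u)+\lambda)\sqrt{\epsilon(v'^2\cosh(u)^2-u'^2)}\,dt,$$ i.e. a solution of its Euler-Lagrange equations. *)

theory Defs
  imports "HOL-Analysis.Analysis"
begin

subsection \<open>Lorentz-Minkowski space and the de Sitter surface\<close>

definition linner :: "real ^ 3 \<Rightarrow> real ^ 3 \<Rightarrow> real" where
  "linner p q = p $ 1 * q $ 1 + p $ 2 * q $ 2 - p $ 3 * q $ 3"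

definition lcross :: "real ^ 3 \<Rightarrow> real ^ 3 \<Rightarrow> real ^ 3" where
  "lcross p q = vector
     [p $ 2 * q $ 3 - p $ 3 * q $ 2,
      p $ 3 * q $ 1 - p $ 1 * q $ 3,
      - (p $ 1 * q $ 2 - p $ 2 * q $ 1)]"

lemma linner_lcross: "linner (lcross p q) r = det (vector [p, q, r] :: real ^ 3 ^ 3)"
  by (simp add: linner_def lcross_def det_3 algebra_simps)

definition de_sitter :: "(real ^ 3) set" where
  "de_sitter = {p. linner p p = 1}"

definition de_sitter_upper :: "(real ^ 3) set" where
  "de_sitter_upper = {p \<in> de_sitter. p $ 3 > 0}"

definition normal_field :: "real ^ 3 \<Rightarrow> real ^ 3" where
  "normal_field p = - p"

definition \<Psi> :: "real \<Rightarrow> real \<Rightarrow> real ^ 3" where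
  "\<Psi> u v = vector [cosh u * cos v, cosh u * sin v, sinh u]"


subsection \<open>Curves on a compact interval\<close>

text \<open>Derivatives are relative to the interval, hence one-sided at its endpoints.\<close>

definition deriv_on :: "real \<Rightarrow> real \<Rightarrow> (real \<Rightarrow> 'a::real_normed_vector) \<Rightarrow> real \<Rightarrow> 'a" where
  "deriv_on a b f t = vector_derivative f (at t within {a..b})"

definition smooth_on_interval :: "real \<Rightarrow> real \<Rightarrow> (real \<Rightarrow> 'a::real_normed_vector) \<Rightarrow> bool" where
  "smooth_on_interval a b f \<longleftrightarrow> (\<forall>n. ((deriv_on a b ^^ n) f) differentiable_on {a..b})"

definition spacelike_curve :: "real \<Rightarrow> real \<Rightarrow> (real \<Rightarrow> real ^ 3) \<Rightarrow> bool" where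
  "spacelike_curve a b \<gamma> \<longleftrightarrow>
     (\<forall>t\<in>{a..b}. linner (deriv_on a b \<gamma> t) (deriv_on a b \<gamma> t) > 0)"

definition timelike_curve :: "real \<Rightarrow> real \<Rightarrow> (real \<Rightarrow> real ^ 3) \<Rightarrow> bool" where
  "timelike_curve a b \<gamma> \<longleftrightarrow>
     (\<forall>t\<in>{a..b}. linner (deriv_on a b \<gamma> t) (deriv_on a b \<gamma> t) < 0)"

definition nondegenerate_curve :: "real \<Rightarrow> real \<Rightarrow> (real \<Rightarrow> real ^ 3) \<Rightarrow> bool" where
  "nondegenerate_curve a b \<gamma> \<longleftrightarrow> spacelike_curve a b \<gamma> \<or> timelike_curve a b \<gamma>"

text \<open>The sign \<open>\<epsilon>\<close>; only meaningful for non-degenerate curves on a nonempty interval.\<close>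

definition causal_sign :: "real \<Rightarrow> real \<Rightarrow> (real \<Rightarrow> real ^ 3) \<Rightarrow> real" where
  "causal_sign a b \<gamma> = (if spacelike_curve a b \<gamma> then 1 else - 1)"

definition lspeed :: "real \<Rightarrow> real \<Rightarrow> (real \<Rightarrow> real ^ 3) \<Rightarrow> real \<Rightarrow> real" where
  "lspeed a b \<gamma> t =
     sqrt (causal_sign a b \<gamma> * linner (deriv_on a b \<gamma> t) (deriv_on a b \<gamma> t))"

definition curvature :: "real \<Rightarrow> real \<Rightarrow> (real \<Rightarrow> real ^ 3) \<Rightarrow> real \<Rightarrow> real" where
  "curvature a b \<gamma> t =
     causal_sign a b \<gamma> *
       (linner (deriv_on a b (deriv_on a b \<gamma>) t)
          (lcross (deriv_on a b \<gamma> t) (normal_field (\<gamma> t))) / lspeed a b \<gamma> t ^ 3)"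

lemma curvature_eq_det:
  "curvature a b \<gamma> t =
     causal_sign a b \<gamma> *
       (det (vector [\<gamma> t, deriv_on a b \<gamma> t, deriv_on a b (deriv_on a b \<gamma>) t] :: real ^ 3 ^ 3)
          / lspeed a b \<gamma> t ^ 3)"
  by (simp add: curvature_def normal_field_def linner_def lcross_def det_3 algebra_simps)


subsection \<open>Catenaries\<close>

definition energy_xy ::
  "real \<Rightarrow> real \<Rightarrow> real \<Rightarrow> real \<Rightarrow> (real \<Rightarrow> real) \<Rightarrow> (real \<Rightarrow> real) \<Rightarrow> real" where
  "energy_xy \<epsilon> a b \<Lambda> u v =
     integral {a..b} (\<lambda>t. (sinh (u t) + \<Lambda>) *
       sqrt (\<epsilon> * ((deriv_on a b v t)\<^sup>2 * (cosh (u t))\<^sup>2 - (deriv_on a b u t)\<^sup>2)))"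

text \<open>
  The curve \<open>t \<mapsto> \<Psi> (u t) (v t)\<close> is a critical point of the energy: the first variation vanishes
  for all smooth variations with fixed endpoints.  For a smooth non-degenerate curve in the upper
  part the varied curves are, by compactness of \<open>[a, b]\<close>, for all small \<open>s\<close> again in the upper part
  and of the same causal character, so the sign \<open>\<epsilon>\<close> is that of the given curve.
\<close>

definition catenary_xy ::
  "real \<Rightarrow> real \<Rightarrow> real \<Rightarrow> (real \<Rightarrow> real) \<Rightarrow> (real \<Rightarrow> real) \<Rightarrow> bool" where
  "catenary_xy a b \<Lambda> u v \<longleftrightarrow>
     (\<forall>\<eta> \<theta>. smooth_on_interval a b \<eta> \<and> smooth_on_interval a b \<theta> \<and>
             \<eta> a = 0 \<and> \<eta> b = 0 \<and> \<theta> a = 0 \<and> \<theta> b = 0 \<longrightarrow>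
        ((\<lambda>s. energy_xy (causal_sign a b (\<lambda>t. \<Psi> (u t) (v t))) a b \<Lambda>
                 (\<lambda>t. u t + s * \<eta> t) (\<lambda>t. v t + s * \<theta> t))
           has_real_derivative 0) (at 0))"

end

theory Submission imports Defs begin

text \<open>
  Let \<open>L\<close> be the Lagrangian and \<open>W\<close> the speed.  Since \<open>L\<close> is invariant under reparametrisation,
  its two Euler-Lagrange expressions are \<open>v' E\<close> and \<open>- u' E\<close> for a single function \<open>E\<close>, so they
  vanish together exactly when \<open>E\<close> does, as \<open>(u', v') \<noteq> 0\<close> along a non-degenerate curve.  A
  computation gives \<open>E = cosh u / W * (\<epsilon> v' cosh\<^sup>2 u + (sinh u + \<Lambda>) D / W\<^sup>2)\<close> with
  \<open>D = det (\<gamma>, \<gamma>', \<gamma>'')\<close>, and \<open>E = 0\<close> is the stated curvature equation because \<open>\<kappa> = \<epsilon> D / W\<^sup>3\<close>.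
  To deduce \<open>E = 0\<close> from criticality, test functions \<open>(t - a) (b - t) P t\<close> with \<open>P\<close> a polynomial suffice, by the
  Weierstrass approximation theorem.
\<close>

section \<open>Derivatives and smoothness on a compact interval\<close>

lemma has_vector_derivative_vector3:
  assumes "(f has_real_derivative f') (at t within S)"
    and "(g has_real_derivative g') (at t within S)"
    and "(h has_real_derivative h') (at t within S)"
  shows "((\<lambda>t. vector [f t, g t, h t] :: real ^ 3) has_vector_derivative vector [f', g', h'])
           (at t within S)"
proof -
  have expand: "(vector [x, y, z] :: real ^ 3) = x *\<^sub>R axis 1 1 + y *\<^sub>R axis 2 1 + z *\<^sub>R axis 3 1"
    for x y z
    by (simp add: vec_eq_iff forall_3 axis_def)
  show ?thesis
    unfolding expand by (rule derivative_eq_intros assms refl | simp)+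
qed

lemma deriv_on_eqI:
  assumes "a < b" "t \<in> {a..b}" "(f has_vector_derivative f') (at t within {a..b})"
  shows "deriv_on a b f t = f'"
  using vector_derivative_within_cbox[of a b t f f'] assms by (simp add: deriv_on_def)

text \<open>Outside \<open>{a..b}\<close> the value of \<open>deriv_on\<close> is arbitrary, so
  closed forms for it hold on the interval only. This lets such a form be differentiated again
  there.\<close>

lemma deriv_on_cong:
  assumes "\<And>x. x \<in> {a..b} \<Longrightarrow> f x = g x" "t \<in> {a..b}"
  shows "deriv_on a b f t = deriv_on a b g t"
proof -
  have "(f has_vector_derivative D) (at t within {a..b}) \<longleftrightarrow> (g has_vector_derivative D) (at t within {a..b})" for D
    using assms by (metis has_vector_derivative_transform)
  then show ?thesis by (simp add: deriv_on_def vector_derivative_def)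
qed

lemma smooth_on_interval_deriv:
  assumes "smooth_on_interval a b f"
  shows "smooth_on_interval a b (deriv_on a b f)"
  using assms unfolding smooth_on_interval_def by (metis funpow_Suc_right o_apply)

lemma smooth_on_interval_has_derivative:
  fixes f :: "real \<Rightarrow> real"
  assumes "smooth_on_interval a b f" "t \<in> {a..b}"
  shows "(f has_real_derivative deriv_on a b f t) (at t within {a..b})"
proof -
  have "f differentiable (at t within {a..b})"
    using assms by (fastforce simp: smooth_on_interval_def differentiable_on_def dest: spec[of _ 0])
  then show ?thesis
    by (simp add: vector_derivative_works deriv_on_def has_real_derivative_iff_has_vector_derivative)
qed

lemma smooth_on_interval_continuous:
  fixes f :: "real \<Rightarrow> real"
  assumes "smooth_on_interval a b f"
  shows "continuous_on {a..b} f"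
  using smooth_on_interval_has_derivative[OF assms] by (rule DERIV_continuous_on)

text \<open>On \<open>{a..b}\<close> every iterated derivative agrees with a polynomial, which is
  differentiable everywhere. This supplies the test functions for criticality.\<close>

lemma smooth_on_interval_polynomial:
  assumes "a < b" "real_polynomial_function f"
  shows "smooth_on_interval a b f"
proof -
  have "\<exists>g. real_polynomial_function g \<and> (\<forall>t\<in>{a..b}. (deriv_on a b ^^ n) f t = g t)" for n
  proof (induction n)
    case 0
    show ?case using assms(2) by auto
  next
    case (Suc n)
    then obtain g where g: "real_polynomial_function g" "\<And>t. t \<in> {a..b} \<Longrightarrow> (deriv_on a b ^^ n) f t = g t"
      by blast
    obtain g' where g': "real_polynomial_function g'" "\<And>t. (g has_real_derivative g' t) (at t)"
      using has_real_derivative_polynomial_function[OF g(1)] by blast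
    have "(deriv_on a b ^^ Suc n) f t = g' t" if "t \<in> {a..b}" for t
    proof -
      have "(deriv_on a b ^^ Suc n) f t = deriv_on a b g t"
        using deriv_on_cong[OF g(2) that] by simp
      also have "\<dots> = g' t"
        using g'(2) that assms(1)
        by (intro deriv_on_eqI) (auto intro: has_field_derivative_at_within simp flip: has_real_derivative_iff_has_vector_derivative)
      finally show ?thesis .
    qed
    with g'(1) show ?case by blast
  qed
  then show ?thesis
    unfolding smooth_on_interval_def differentiable_on_def
    by (metis differentiable_at_real_polynomial_function differentiable_at_withinI
        differentiable_transform_within zero_less_one)
qed

section \<open>Fundamental lemma of the calculus of variations\<close>

text \<open>The weight \<open>(t - a) * (b - t)\<close> vanishes at the endpoints and is positive in
  between. Approximating \<open>f\<close> uniformly by polynomials shows that the weighted integral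
  of the square of \<open>f\<close> is zero.\<close>

lemma fundamental_lemma_polynomial:
  fixes f :: "real \<Rightarrow> real"
  assumes "a < b" and f: "continuous_on {a..b} f"
    and zero: "\<And>P. real_polynomial_function P \<Longrightarrow>
                 integral {a..b} (\<lambda>t. f t * ((t - a) * (b - t) * P t)) = 0"
    and "t \<in> {a..b}"
  shows "f t = 0"
proof -
  define g where "g t = f t * ((t - a) * (b - t))" for t
  have g: "continuous_on {a..b} g"
    unfolding g_def by (intro continuous_intros f)
  define I where "I = integral {a..b} (\<lambda>t. g t * f t)"
  define B where "B = integral {a..b} (\<lambda>t. \<bar>g t\<bar>)"
  have "B \<ge> 0"
    unfolding B_def by (rule integral_nonneg) (auto intro!: integrable_continuous_interval continuous_intros g)
  \<comment> \<open>For a polynomial \<open>P\<close> within \<open>e\<close> of \<open>f\<close>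
    the integral of \<open>g t * P t\<close> vanishes by hypothesis, so only the error
    \<open>f t - P t\<close> contributes to \<open>I\<close>.\<close>
  have bound: "\<bar>I\<bar> \<le> e * B" if e: "e > 0" for e
  proof -
    obtain P where P: "real_polynomial_function P" "\<And>x. x \<in> {a..b} \<Longrightarrow> \<bar>f x - P x\<bar> < e"
      using Stone_Weierstrass_real_polynomial_function[OF compact_Icc f e] by blast
    have cP: "continuous_on {a..b} P"
      using P(1) continuous_on_polymonial_function real_polynomial_function_eq by blast
    have "I = integral {a..b} (\<lambda>t. g t * f t) - integral {a..b} (\<lambda>t. g t * P t)"
      using zero[OF P(1)] by (simp add: I_def g_def mult.assoc)
    also have "\<dots> = integral {a..b} (\<lambda>t. g t * (f t - P t))"
      unfolding right_diff_distrib
      by (intro integral_diff[symmetric] integrable_continuous_interval continuous_intros g f cP)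
    finally have "\<bar>I\<bar> \<le> integral {a..b} (\<lambda>t. e * \<bar>g t\<bar>)"
    proof (simp only: flip: real_norm_def, intro integral_norm_bound_integral)
      fix x assume x: "x \<in> {a..b}"
      show "norm (g x * (f x - P x)) \<le> e * norm (g x)"
        using mult_left_mono[OF less_imp_le[OF P(2)[OF x]], of "\<bar>g x\<bar>"]
        by (simp add: abs_mult mult.commute)
    qed (intro integrable_continuous_interval continuous_intros g f cP)+
    then show ?thesis by (simp add: B_def)
  qed
  have "I = 0"
  proof (rule ccontr)
    assume "I \<noteq> 0"
    \<comment> \<open>This choice of \<open>e\<close> contradicts \<open>bound\<close>;
      \<open>B + 1\<close> keeps the denominator positive even if \<open>B = 0\<close>.\<close>
    have "\<bar>I\<bar> / (2 * (B + 1)) * B < \<bar>I\<bar>"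
      using \<open>I \<noteq> 0\<close> \<open>B \<ge> 0\<close> by (simp add: field_simps add_nonneg_pos)
    with bound[of "\<bar>I\<bar> / (2 * (B + 1))"] \<open>I \<noteq> 0\<close> \<open>B \<ge> 0\<close> show False by simp
  qed
  have "\<forall>x\<in>{a..b}. g x * f x = 0"
  proof (subst integral_eq_0_iff[symmetric])
    show "continuous_on {a..b} (\<lambda>x. g x * f x)" by (intro continuous_intros g f)
    show "0 \<le> g x * f x" if "x \<in> {a..b}" for x
    proof -
      have "g x * f x = (f x)\<^sup>2 * ((x - a) * (b - x))" by (simp add: g_def power2_eq_square)
      then show ?thesis using that by simp
    qed
  qed (use \<open>I = 0\<close> \<open>a < b\<close> in \<open>auto simp: I_def\<close>)
  then have "f x = 0" if "x \<in> {a<..<b}" for x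
    using that by (force simp: g_def)
  \<comment> \<open>The weight hides the values at \<open>a\<close> and \<open>b\<close>; these
    follow by continuity.\<close>
  then show ?thesis
    using continuous_constant_on_closure[of "{a<..<b}" f 0 t] assms
    by (simp add: closure_greaterThanLessThan)
qed

section \<open>Algebraic identities for the Euler-Lagrange expressions\<close>

text \<open>Here \<open>c\<close>, \<open>s\<close> stand for \<open>cosh u\<close>,
  \<open>sinh u\<close>, \<open>W\<close> for the speed, and \<open>p\<close>, \<open>q\<close>,
  \<open>pp\<close>, \<open>qq\<close> for \<open>u'\<close>, \<open>v'\<close>, \<open>u''\<close>,
  \<open>v''\<close>. The left side is the quotient rule applied to
  \<open>(s + L) * e * q * c\<^sup>2 / W\<close>. Multiplication by \<open>W ^ 3\<close> leaves a
  polynomial identity modulo the three equations assumed.\<close>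

lemma momentum_v_identity:
  fixes c s e W L p q pp qq :: real
  assumes "W > 0" "W\<^sup>2 = e * (q\<^sup>2 * c\<^sup>2 - p\<^sup>2)" "e * e = 1" "c\<^sup>2 = s\<^sup>2 + 1"
  shows "((c * p * e * q * c\<^sup>2 + (s + L) * e * (qq * c\<^sup>2 + q * (2 * c * s * p))) * W
     - (s + L) * e * q * c\<^sup>2 * (e * (q * qq * c\<^sup>2 + q\<^sup>2 * c * s * p - p * pp) / W)) / W\<^sup>2
   = p * (c / W * (e * c\<^sup>2 * q + (s + L) * (c * (q * pp - p * qq) - 2 * s * p\<^sup>2 * q + s * c\<^sup>2 * q ^ 3) / W\<^sup>2))"
proof -
  have "(c * p * e * q * c\<^sup>2 + (s + L) * e * (qq * c\<^sup>2 + q * (2 * c * s * p))) * W\<^sup>2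
     - (s + L) * e * q * c\<^sup>2 * (e * (q * qq * c\<^sup>2 + q\<^sup>2 * c * s * p - p * pp))
   = p * c * (e * c\<^sup>2 * q * W\<^sup>2 + (s + L) * (c * (q * pp - p * qq) - 2 * s * p\<^sup>2 * q + s * c\<^sup>2 * q ^ 3))"
    using assms(2-4) by algebra
  with assms(1) show ?thesis by (simp add: divide_simps) (simp add: algebra_simps power2_eq_square)
qed

text \<open>In the same notation, the left side is the derivative of
  \<open>- ((s + L) * e * p / W)\<close>, and the first two terms on the right are the partial
  derivative of the Lagrangian in \<open>u\<close>. Again \<open>W ^ 3\<close> clears the
  denominators.\<close>

lemma momentum_u_identity:
  fixes c s e W L p q pp qq :: real
  assumes "W > 0" "W\<^sup>2 = e * (q\<^sup>2 * c\<^sup>2 - p\<^sup>2)" "e * e = 1" "c\<^sup>2 = s\<^sup>2 + 1"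
  shows "- (((c * p * e * p + (s + L) * e * pp) * W
     - (s + L) * e * p * (e * (q * qq * c\<^sup>2 + q\<^sup>2 * c * s * p - p * pp) / W)) / W\<^sup>2)
   = c * W + (s + L) * e * q\<^sup>2 * c * s / W
      - q * (c / W * (e * c\<^sup>2 * q + (s + L) * (c * (q * pp - p * qq) - 2 * s * p\<^sup>2 * q + s * c\<^sup>2 * q ^ 3) / W\<^sup>2))"
proof -
  have "- ((c * p * e * p + (s + L) * e * pp) * W\<^sup>2
     - (s + L) * e * p * (e * (q * qq * c\<^sup>2 + q\<^sup>2 * c * s * p - p * pp)))
   = c * (W\<^sup>2)\<^sup>2 + (s + L) * e * q\<^sup>2 * c * s * W\<^sup>2
      - q * c * (e * c\<^sup>2 * q * W\<^sup>2 + (s + L) * (c * (q * pp - p * qq) - 2 * s * p\<^sup>2 * q + s * c\<^sup>2 * q ^ 3))"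
    using assms(2-4) by algebra
  with assms(1) show ?thesis by (simp add: divide_simps) (simp add: algebra_simps power2_eq_square power4_eq_xxxx)
qed

section \<open>The variational problem in the coordinates \<open>u\<close>, \<open>v\<close>\<close>

text \<open>The sign is kept abstract, known only through its square and the positive radicand, so
  that spacelike and timelike curves are treated together.\<close>

locale nondegenerate_pair =
  fixes a b \<epsilon> \<Lambda> :: real and u v :: "real \<Rightarrow> real"
  assumes ab: "a < b"
    and u: "smooth_on_interval a b u"
    and v: "smooth_on_interval a b v"
    and eps: "\<epsilon> * \<epsilon> = 1"
    and pos: "t \<in> {a..b} \<Longrightarrow>
      0 < \<epsilon> * ((deriv_on a b v t)\<^sup>2 * (cosh (u t))\<^sup>2 - (deriv_on a b u t)\<^sup>2)"
begin

abbreviation "u' \<equiv> deriv_on a b u"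
abbreviation "v' \<equiv> deriv_on a b v"
abbreviation "u'' \<equiv> deriv_on a b u'"
abbreviation "v'' \<equiv> deriv_on a b v'"

definition speed :: "real \<Rightarrow> real" where
  "speed t = sqrt (\<epsilon> * ((v' t)\<^sup>2 * (cosh (u t))\<^sup>2 - (u' t)\<^sup>2))"

text \<open>The determinant of position, velocity and acceleration in coordinates; see
  \<open>det_\<Psi>\<close>.\<close>

definition curve_det :: "real \<Rightarrow> real" where
  "curve_det t = cosh (u t) * (v' t * u'' t - u' t * v'' t) - 2 * sinh (u t) * (u' t)\<^sup>2 * v' t
                 + sinh (u t) * (cosh (u t))\<^sup>2 * v' t ^ 3"

text \<open>The common factor of both Euler-Lagrange expressions: partial derivative minus
  derivative of the momentum is \<open>v' t * euler_lagrange t\<close> for \<open>u\<close> and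
  \<open>- u' t * euler_lagrange t\<close> for \<open>v\<close>.\<close>

definition euler_lagrange :: "real \<Rightarrow> real" where
  "euler_lagrange t = cosh (u t) / speed t *
     (\<epsilon> * (cosh (u t))\<^sup>2 * v' t + (sinh (u t) + \<Lambda>) * curve_det t / (speed t)\<^sup>2)"

lemma speed_pos: "t \<in> {a..b} \<Longrightarrow> 0 < speed t"
  using pos by (simp add: speed_def)

lemma speed_power2:
  "t \<in> {a..b} \<Longrightarrow> (speed t)\<^sup>2 = \<epsilon> * ((v' t)\<^sup>2 * (cosh (u t))\<^sup>2 - (u' t)\<^sup>2)"
  using pos by (simp add: speed_def less_imp_le)

lemmas has_derivs =
  smooth_on_interval_has_derivative[OF u] smooth_on_interval_has_derivative[OF v]
  smooth_on_interval_has_derivative[OF smooth_on_interval_deriv[OF u]]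
  smooth_on_interval_has_derivative[OF smooth_on_interval_deriv[OF v]]

lemmas conts =
  smooth_on_interval_continuous[OF u] smooth_on_interval_continuous[OF v]
  smooth_on_interval_continuous[OF smooth_on_interval_deriv[OF u]]
  smooth_on_interval_continuous[OF smooth_on_interval_deriv[OF v]]
  smooth_on_interval_continuous[OF smooth_on_interval_deriv[OF smooth_on_interval_deriv[OF u]]]
  smooth_on_interval_continuous[OF smooth_on_interval_deriv[OF smooth_on_interval_deriv[OF v]]]

lemma continuous_on_speed: "continuous_on {a..b} speed"
  unfolding speed_def by (intro continuous_intros conts)

lemma continuous_on_euler_lagrange: "continuous_on {a..b} euler_lagrange"
  unfolding euler_lagrange_def curve_det_def
  by (intro continuous_intros conts continuous_on_speed) (auto dest: speed_pos)

section \<open>Differentiation of the energy under the integral\<close>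

text \<open>The Leibniz rule applies because, for small \<open>s\<close>, the radicand stays
  positive on the whole interval. The Lagrangian does not involve \<open>v\<close> itself, so
  \<open>k\<close> enters only through its derivative.\<close>

lemma energy_xy_has_derivative:
  assumes h: "smooth_on_interval a b h" and k: "smooth_on_interval a b k"
  shows "((\<lambda>s. energy_xy \<epsilon> a b \<Lambda> (\<lambda>t. u t + s * h t) (\<lambda>t. v t + s * k t)) has_real_derivative
           integral {a..b} (\<lambda>t.
             (cosh (u t) * speed t + (sinh (u t) + \<Lambda>) * \<epsilon> * (v' t)\<^sup>2 * cosh (u t) * sinh (u t) / speed t) * h t
             - (sinh (u t) + \<Lambda>) * \<epsilon> * u' t / speed t * deriv_on a b h t
             + (sinh (u t) + \<Lambda>) * \<epsilon> * v' t * (cosh (u t))\<^sup>2 / speed t * deriv_on a b k t)) (at 0)"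
proof -
  let ?h' = "deriv_on a b h" and ?k' = "deriv_on a b k"
  \<comment> \<open>Joint continuity in \<open>s\<close> and \<open>t\<close> needs these functions
    composed with the projection to \<open>t\<close>.\<close>
  note [continuous_intros] = conts[THEN continuous_on_compose2]
    smooth_on_interval_continuous[OF h, THEN continuous_on_compose2]
    smooth_on_interval_continuous[OF smooth_on_interval_deriv[OF h], THEN continuous_on_compose2]
    smooth_on_interval_continuous[OF smooth_on_interval_deriv[OF k], THEN continuous_on_compose2]
  define G where "G s t = \<epsilon> * ((v' t + s * ?k' t)\<^sup>2 * (cosh (u t + s * h t))\<^sup>2 - (u' t + s * ?h' t)\<^sup>2)" for s t
  define F where "F s t = (sinh (u t + s * h t) + \<Lambda>) * sqrt (G s t)" for s t
  define F' where "F' s t = cosh (u t + s * h t) * h t * sqrt (G s t)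
    + (sinh (u t + s * h t) + \<Lambda>) * (\<epsilon> * ((v' t + s * ?k' t) * ?k' t * (cosh (u t + s * h t))\<^sup>2
        + (v' t + s * ?k' t)\<^sup>2 * cosh (u t + s * h t) * sinh (u t + s * h t) * h t
        - (u' t + s * ?h' t) * ?h' t)) / sqrt (G s t)" for s t
  have contG: "continuous_on (UNIV \<times> {a..b}) (\<lambda>x. G (fst x) (snd x))"
    unfolding G_def by (intro continuous_intros) auto
  \<comment> \<open>By compactness the unperturbed radicand has a positive minimum.\<close>
  obtain m where m: "m \<in> {a..b}" "\<And>t. t \<in> {a..b} \<Longrightarrow> G 0 m \<le> G 0 t"
  proof -
    have "continuous_on {a..b} (G 0)"
      unfolding G_def by (intro continuous_intros) auto
    from continuous_attains_inf[OF compact_Icc _ this] ab that show thesis by auto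
  qed
  have Gm: "0 < G 0 m" using pos[OF m(1)] by (simp add: G_def)
  \<comment> \<open>Compactness gives one neighbourhood of \<open>0\<close> for all
    \<open>t\<close>; a tolerance of half the minimum keeps the radicand positive.\<close>
  obtain X where X: "0 \<in> X" "open X"
    "\<forall>s\<in>X \<inter> UNIV. \<forall>t\<in>{a..b}. dist (G (fst (s, t)) (snd (s, t))) (G (fst (0, t)) (snd (0, t))) \<le> G 0 m / 2"
    by (rule continuous_on_prod_compactE[OF contG compact_Icc UNIV_I, of "G 0 m / 2" 0]) (use Gm in auto)
  have Gpos: "0 < G s t" if "s \<in> X" "t \<in> {a..b}" for s t
  proof -
    have "\<bar>G s t - G 0 t\<bar> \<le> G 0 m / 2" using X(3) that by (simp add: dist_real_def)
    with m(2)[OF that(2)] Gm show ?thesis by linarith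
  qed
  \<comment> \<open>The Leibniz rule asks for a convex parameter set, hence a ball.\<close>
  obtain r where r: "r > 0" "ball 0 r \<subseteq> X" using X openE by blast
  have "((\<lambda>s. integral (cbox a b) (F s)) has_field_derivative integral (cbox a b) (F' 0)) (at 0 within ball 0 r)"
  proof (rule leibniz_rule_field_derivative)
    fix s t assume st: "s \<in> ball (0::real) r" "t \<in> cbox a b"
    then have g: "0 < G s t" using Gpos r by auto
    have dG: "((\<lambda>s. G s t) has_real_derivative 2 * (\<epsilon> * ((v' t + s * ?k' t) * ?k' t * (cosh (u t + s * h t))\<^sup>2
        + (v' t + s * ?k' t)\<^sup>2 * cosh (u t + s * h t) * sinh (u t + s * h t) * h t
        - (u' t + s * ?h' t) * ?h' t))) (at s within ball 0 r)"
      unfolding G_def by (rule derivative_eq_intros refl | simp add: algebra_simps)+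
    show "((\<lambda>s. F s t) has_field_derivative F' s t) (at s within ball 0 r)"
      unfolding F_def F'_def
      by (rule derivative_eq_intros dG DERIV_chain2[OF DERIV_real_sqrt[OF g] dG] refl | simp)+
         (use g in \<open>simp add: field_simps\<close>)
  next
    fix s :: real assume "s \<in> ball 0 r"
    show "F s integrable_on cbox a b"
      unfolding F_def G_def by (simp, intro integrable_continuous_interval continuous_intros) auto
  next
    have "continuous_on (ball 0 r \<times> {a..b}) (\<lambda>x. G (fst x) (snd x))"
      by (rule continuous_on_subset[OF contG]) auto
    then show "continuous_on (ball 0 r \<times> cbox a b) (\<lambda>(s, t). F' s t)"
      unfolding F'_def split_beta
      by (intro continuous_intros) (use Gpos r(2) in \<open>auto simp: mem_Times_iff, fastforce\<close>)
  qed (use r in auto)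
  then have "((\<lambda>s. integral {a..b} (F s)) has_real_derivative integral {a..b} (F' 0)) (at 0)"
    using r(1) by (simp add: at_within_open[of 0 "ball 0 r"])
  moreover have "energy_xy \<epsilon> a b \<Lambda> (\<lambda>t. u t + s * h t) (\<lambda>t. v t + s * k t) = integral {a..b} (F s)" for s
  proof -
    have lin: "deriv_on a b (\<lambda>t. w t + s * y t) t = deriv_on a b w t + s * deriv_on a b y t"
      if "smooth_on_interval a b w" "smooth_on_interval a b y" "t \<in> {a..b}" for w y t
      using that ab
      by (intro deriv_on_eqI)
         (auto simp flip: has_real_derivative_iff_has_vector_derivative
               intro!: derivative_eq_intros smooth_on_interval_has_derivative)
    show ?thesis
      unfolding energy_xy_def F_def G_def
      by (rule integral_cong) (simp add: lin u v h k)
  qed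
  moreover have "integral {a..b} (F' 0) = integral {a..b} (\<lambda>t.
             (cosh (u t) * speed t + (sinh (u t) + \<Lambda>) * \<epsilon> * (v' t)\<^sup>2 * cosh (u t) * sinh (u t) / speed t) * h t
             - (sinh (u t) + \<Lambda>) * \<epsilon> * u' t / speed t * deriv_on a b h t
             + (sinh (u t) + \<Lambda>) * \<epsilon> * v' t * (cosh (u t))\<^sup>2 / speed t * deriv_on a b k t)"
  proof (rule integral_cong)
    fix t assume t: "t \<in> {a..b}"
    have "sqrt (G 0 t) = speed t"
      by (simp add: G_def speed_def)
    with speed_pos[OF t] show "F' 0 t =
             (cosh (u t) * speed t + (sinh (u t) + \<Lambda>) * \<epsilon> * (v' t)\<^sup>2 * cosh (u t) * sinh (u t) / speed t) * h t
             - (sinh (u t) + \<Lambda>) * \<epsilon> * u' t / speed t * deriv_on a b h t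
             + (sinh (u t) + \<Lambda>) * \<epsilon> * v' t * (cosh (u t))\<^sup>2 / speed t * deriv_on a b k t"
      by (simp add: F'_def field_simps)
  qed
  ultimately show ?thesis by simp
qed

section \<open>Derivatives of the momenta\<close>

lemma speed_has_derivative:
  assumes t: "t \<in> {a..b}"
  shows "(speed has_real_derivative
     \<epsilon> * (v' t * v'' t * (cosh (u t))\<^sup>2 + (v' t)\<^sup>2 * cosh (u t) * sinh (u t) * u' t - u' t * u'' t) / speed t)
     (at t within {a..b})"
proof -
  have "((\<lambda>t. \<epsilon> * ((v' t)\<^sup>2 * (cosh (u t))\<^sup>2 - (u' t)\<^sup>2)) has_real_derivative
     2 * (\<epsilon> * (v' t * v'' t * (cosh (u t))\<^sup>2 + (v' t)\<^sup>2 * cosh (u t) * sinh (u t) * u' t - u' t * u'' t)))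
     (at t within {a..b})"
    by (rule derivative_eq_intros has_derivs t refl | simp add: algebra_simps)+
  from DERIV_chain2[OF DERIV_real_sqrt[OF pos[OF t]] this]
  show ?thesis
    unfolding speed_def[symmetric] by (rule DERIV_cong) (use speed_pos[OF t] in \<open>simp add: field_simps\<close>)
qed

text \<open>The Euler-Lagrange expression for \<open>u\<close>: the differentiated function is the
  momentum conjugate to \<open>u\<close>, and the terms before the subtraction are the partial
  derivative of the Lagrangian in \<open>u\<close>.\<close>

lemma momentum_u_has_derivative:
  assumes t: "t \<in> {a..b}"
  shows "((\<lambda>t. - ((sinh (u t) + \<Lambda>) * \<epsilon> * u' t / speed t)) has_real_derivative
     cosh (u t) * speed t + (sinh (u t) + \<Lambda>) * \<epsilon> * (v' t)\<^sup>2 * cosh (u t) * sinh (u t) / speed t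
     - v' t * euler_lagrange t) (at t within {a..b})"
proof -
  have "((\<lambda>t. (sinh (u t) + \<Lambda>) * \<epsilon> * u' t) has_real_derivative
      cosh (u t) * u' t * \<epsilon> * u' t + (sinh (u t) + \<Lambda>) * \<epsilon> * u'' t) (at t within {a..b})"
    by (rule derivative_eq_intros has_derivs t refl | simp)+
  from DERIV_minus[OF DERIV_divide[OF this speed_has_derivative[OF t]]] speed_pos[OF t]
  show ?thesis
    unfolding euler_lagrange_def curve_det_def
      momentum_u_identity[OF speed_pos[OF t] speed_power2[OF t] eps cosh_square_eq, symmetric]
    unfolding power2_eq_square[of "speed t"] by simp
qed

text \<open>The Lagrangian is independent of \<open>v\<close>, so the derivative of the conjugate
  momentum is, up to sign, the whole Euler-Lagrange expression for \<open>v\<close>.\<close>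

lemma momentum_v_has_derivative:
  assumes t: "t \<in> {a..b}"
  shows "((\<lambda>t. (sinh (u t) + \<Lambda>) * \<epsilon> * v' t * (cosh (u t))\<^sup>2 / speed t) has_real_derivative
     u' t * euler_lagrange t) (at t within {a..b})"
proof -
  have "((\<lambda>t. (sinh (u t) + \<Lambda>) * \<epsilon> * v' t * (cosh (u t))\<^sup>2) has_real_derivative
      cosh (u t) * u' t * \<epsilon> * v' t * (cosh (u t))\<^sup>2
      + (sinh (u t) + \<Lambda>) * \<epsilon> * (v'' t * (cosh (u t))\<^sup>2 + v' t * (2 * cosh (u t) * sinh (u t) * u' t)))
      (at t within {a..b})"
    by (rule derivative_eq_intros has_derivs t refl | simp add: algebra_simps)+
  from DERIV_divide[OF this speed_has_derivative[OF t]] speed_pos[OF t]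
  show ?thesis
    unfolding euler_lagrange_def curve_det_def
      momentum_v_identity[OF speed_pos[OF t] speed_power2[OF t] eps cosh_square_eq, symmetric]
    unfolding power2_eq_square[of "speed t"] by simp
qed

section \<open>First variation and critical points\<close>

text \<open>Integration by parts moves the derivatives from \<open>h\<close> and \<open>k\<close>
  onto the momenta; the boundary terms vanish with \<open>h\<close> and \<open>k\<close>.\<close>

lemma first_variation:
  assumes h: "smooth_on_interval a b h" "h a = 0" "h b = 0"
    and k: "smooth_on_interval a b k" "k a = 0" "k b = 0"
  shows "((\<lambda>s. energy_xy \<epsilon> a b \<Lambda> (\<lambda>t. u t + s * h t) (\<lambda>t. v t + s * k t)) has_real_derivative
           integral {a..b} (\<lambda>t. euler_lagrange t * (v' t * h t - u' t * k t))) (at 0)"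
proof -
  let ?A = "\<lambda>t. cosh (u t) * speed t + (sinh (u t) + \<Lambda>) * \<epsilon> * (v' t)\<^sup>2 * cosh (u t) * sinh (u t) / speed t"
  let ?M = "\<lambda>t. (sinh (u t) + \<Lambda>) * \<epsilon> * u' t / speed t"
  let ?N = "\<lambda>t. (sinh (u t) + \<Lambda>) * \<epsilon> * v' t * (cosh (u t))\<^sup>2 / speed t"
  let ?E = "\<lambda>t. euler_lagrange t * (v' t * h t - u' t * k t)"
  let ?B = "\<lambda>t. ?A t * h t - ?M t * deriv_on a b h t + ?N t * deriv_on a b k t"
  \<comment> \<open>By the product rule the integrand \<open>?B\<close> of the derivative of the
    energy differs from \<open>?E\<close> by a total derivative.\<close>
  have "((\<lambda>t. - ?M t * h t + ?N t * k t) has_real_derivative ?B t - ?E t) (at t within {a..b})"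
    if t: "t \<in> {a..b}" for t
    by (rule derivative_eq_intros momentum_u_has_derivative[OF t] momentum_v_has_derivative[OF t]
        smooth_on_interval_has_derivative[OF h(1) t] smooth_on_interval_has_derivative[OF k(1) t] refl)+
       (simp add: algebra_simps)
  then have "((\<lambda>t. ?B t - ?E t) has_integral (- ?M b * h b + ?N b * k b) - (- ?M a * h a + ?N a * k a)) {a..b}"
    using ab by (intro fundamental_theorem_of_calculus)
      (auto simp flip: has_real_derivative_iff_has_vector_derivative)
  then have "((\<lambda>t. ?B t - ?E t) has_integral 0) {a..b}"
    by (simp add: h k)
  moreover have "?E integrable_on {a..b}"
    by (intro integrable_continuous_interval continuous_intros continuous_on_euler_lagrange conts
        smooth_on_interval_continuous[OF h(1)] smooth_on_interval_continuous[OF k(1)])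
  ultimately have "((\<lambda>t. (?B t - ?E t) + ?E t) has_integral 0 + integral {a..b} ?E) {a..b}"
    by (intro has_integral_add integrable_integral)
  then have "integral {a..b} ?B = integral {a..b} ?E"
    by (simp add: integral_unique)
  with energy_xy_has_derivative[OF h(1) k(1)] show ?thesis by simp
qed

lemma catenary_xy_iff:
  assumes "causal_sign a b (\<lambda>t. \<Psi> (u t) (v t)) = \<epsilon>"
  shows "catenary_xy a b \<Lambda> u v \<longleftrightarrow> (\<forall>t\<in>{a..b}. euler_lagrange t = 0)"
proof
  assume "\<forall>t\<in>{a..b}. euler_lagrange t = 0"
  then have "integral {a..b} (\<lambda>t. euler_lagrange t * (v' t * h t - u' t * k t)) = integral {a..b} (\<lambda>t. 0)" for h k
    by (intro integral_cong) simp
  then show "catenary_xy a b \<Lambda> u v"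
    unfolding catenary_xy_def assms using first_variation by fastforce
next
  assume cat: "catenary_xy a b \<Lambda> u v"
  have crit: "integral {a..b} (\<lambda>t. euler_lagrange t * (v' t * h t - u' t * k t)) = 0"
    if "smooth_on_interval a b h" "h a = 0" "h b = 0" "smooth_on_interval a b k" "k a = 0" "k b = 0" for h k
    using cat that first_variation[OF that] unfolding catenary_xy_def assms
    by (blast intro: DERIV_unique)
  have bump: "smooth_on_interval a b (\<lambda>t. (t - a) * (b - t) * P t)" if "real_polynomial_function P" for P
    by (rule smooth_on_interval_polynomial[OF ab])
       (intro real_polynomial_function.intros(3,4) real_polynomial_function_diff that
         real_polynomial_function.intros(1,2) bounded_linear_ident)
  have zero: "smooth_on_interval a b (\<lambda>t. 0 :: real)"
    by (rule smooth_on_interval_polynomial[OF ab real_polynomial_function.intros(2)])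
  show "\<forall>t\<in>{a..b}. euler_lagrange t = 0"
  proof
    fix t assume t: "t \<in> {a..b}"
    \<comment> \<open>Only \<open>u\<close> is varied here; the product with \<open>u' t\<close>
      below comes from varying only \<open>v\<close>.\<close>
    have "euler_lagrange t * v' t = 0"
    proof (rule fundamental_lemma_polynomial[OF ab _ _ t])
      fix P :: "real \<Rightarrow> real" assume "real_polynomial_function P"
      from crit[OF bump[OF this] _ _ zero]
      show "integral {a..b} (\<lambda>t. euler_lagrange t * v' t * ((t - a) * (b - t) * P t)) = 0"
        by (simp add: mult.assoc)
    qed (intro continuous_intros continuous_on_euler_lagrange conts)
    moreover have "- (euler_lagrange t * u' t) = 0"
    proof (rule fundamental_lemma_polynomial[OF ab _ _ t])
      fix P :: "real \<Rightarrow> real" assume "real_polynomial_function P"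
      from crit[OF zero _ _ bump[OF this]]
      show "integral {a..b} (\<lambda>t. - (euler_lagrange t * u' t) * ((t - a) * (b - t) * P t)) = 0"
        by (simp add: mult.assoc)
    qed (intro continuous_intros continuous_on_euler_lagrange conts)
    \<comment> \<open>Otherwise the radicand would be zero.\<close>
    moreover have "v' t \<noteq> 0 \<or> u' t \<noteq> 0"
      using pos[OF t] by auto
    ultimately show "euler_lagrange t = 0" by auto
  qed
qed

end

section \<open>The curve in Lorentz-Minkowski space\<close>

context
  fixes a b :: real and u v :: "real \<Rightarrow> real"
  assumes ab: "a < b" and u: "smooth_on_interval a b u" and v: "smooth_on_interval a b v"
begin

lemmas du = smooth_on_interval_has_derivative[OF u]
  and dv = smooth_on_interval_has_derivative[OF v]
  and ddu = smooth_on_interval_has_derivative[OF smooth_on_interval_deriv[OF u]]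
  and ddv = smooth_on_interval_has_derivative[OF smooth_on_interval_deriv[OF v]]

lemma deriv_on_\<Psi>:
  assumes t: "t \<in> {a..b}"
  shows "deriv_on a b (\<lambda>t. \<Psi> (u t) (v t)) t =
    vector [sinh (u t) * deriv_on a b u t * cos (v t) - cosh (u t) * deriv_on a b v t * sin (v t),
            sinh (u t) * deriv_on a b u t * sin (v t) + cosh (u t) * deriv_on a b v t * cos (v t),
            cosh (u t) * deriv_on a b u t]"
  unfolding \<Psi>_def
  by (rule deriv_on_eqI[OF ab t], rule has_vector_derivative_vector3;
      (rule derivative_eq_intros du[OF t] dv[OF t] refl | simp)+)

text \<open>The metric pulled back by \<open>\<Psi>\<close>: the mixed terms cancel, and the
  coefficient of the squared derivative of \<open>u\<close> is
  \<open>(sinh u)\<^sup>2 - (cosh u)\<^sup>2 = - 1\<close>.\<close>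

lemma linner_deriv_on_\<Psi>:
  assumes t: "t \<in> {a..b}"
  shows "linner (deriv_on a b (\<lambda>t. \<Psi> (u t) (v t)) t) (deriv_on a b (\<lambda>t. \<Psi> (u t) (v t)) t) =
    (deriv_on a b v t)\<^sup>2 * (cosh (u t))\<^sup>2 - (deriv_on a b u t)\<^sup>2"
proof -
  have "(sin (v t))\<^sup>2 + (cos (v t))\<^sup>2 = 1" "(cosh (u t))\<^sup>2 = (sinh (u t))\<^sup>2 + 1"
    by (simp_all add: cosh_square_eq)
  then show ?thesis
    unfolding deriv_on_\<Psi>[OF t] linner_def vector_3 by algebra
qed

text \<open>The first two entries are sorted by the radial direction \<open>(cos v, sin v)\<close>
  and the angular direction \<open>(- sin v, cos v)\<close>.\<close>

lemma deriv_on_deriv_on_\<Psi>: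
  assumes t: "t \<in> {a..b}"
  defines "p \<equiv> deriv_on a b u t" and "q \<equiv> deriv_on a b v t"
    and "pp \<equiv> deriv_on a b (deriv_on a b u) t" and "qq \<equiv> deriv_on a b (deriv_on a b v) t"
  shows "deriv_on a b (deriv_on a b (\<lambda>t. \<Psi> (u t) (v t))) t =
    vector [(cosh (u t) * p\<^sup>2 + sinh (u t) * pp - cosh (u t) * q\<^sup>2) * cos (v t)
              - (2 * sinh (u t) * p * q + cosh (u t) * qq) * sin (v t),
            (cosh (u t) * p\<^sup>2 + sinh (u t) * pp - cosh (u t) * q\<^sup>2) * sin (v t)
              + (2 * sinh (u t) * p * q + cosh (u t) * qq) * cos (v t),
            sinh (u t) * p\<^sup>2 + cosh (u t) * pp]"
  unfolding p_def q_def pp_def qq_def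
  by (subst deriv_on_cong[of a b "deriv_on a b (\<lambda>t. \<Psi> (u t) (v t))", OF deriv_on_\<Psi> t], assumption,
      rule deriv_on_eqI[OF ab t], rule has_vector_derivative_vector3;
      (rule derivative_eq_intros du[OF t] dv[OF t] ddu[OF t] ddv[OF t] refl
       | simp add: algebra_simps power2_eq_square)+)

text \<open>Rotations about the third axis preserve the determinant, so \<open>v\<close> enters only
  through its derivatives.\<close>

lemma det_\<Psi>:
  assumes t: "t \<in> {a..b}"
  defines "p \<equiv> deriv_on a b u t" and "q \<equiv> deriv_on a b v t"
    and "pp \<equiv> deriv_on a b (deriv_on a b u) t" and "qq \<equiv> deriv_on a b (deriv_on a b v) t"
  shows "det (vector [\<Psi> (u t) (v t), deriv_on a b (\<lambda>t. \<Psi> (u t) (v t)) t,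
                      deriv_on a b (deriv_on a b (\<lambda>t. \<Psi> (u t) (v t))) t] :: real ^ 3 ^ 3) =
    cosh (u t) * (q * pp - p * qq) - 2 * sinh (u t) * p\<^sup>2 * q + sinh (u t) * (cosh (u t))\<^sup>2 * q ^ 3"
proof -
  have "(sin (v t))\<^sup>2 + (cos (v t))\<^sup>2 = 1" "(cosh (u t))\<^sup>2 = (sinh (u t))\<^sup>2 + 1"
    by (simp_all add: cosh_square_eq)
  then show ?thesis
    unfolding deriv_on_deriv_on_\<Psi>[OF t] deriv_on_\<Psi>[OF t]
      p_def[symmetric] q_def[symmetric] pp_def[symmetric] qq_def[symmetric]
    unfolding \<Psi>_def det_3 vector_3
    by algebra
qed

end

section \<open>Equivalence with the curvature equation\<close>

theorem theorem2p2:
  fixes a b \<Lambda> :: real and u v :: "real \<Rightarrow> real" and \<gamma> :: "real \<Rightarrow> real ^ 3"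
  assumes "a < b"
    and "smooth_on_interval a b u" and "smooth_on_interval a b v"
    and "\<gamma> = (\<lambda>t. \<Psi> (u t) (v t))"
    and "nondegenerate_curve a b \<gamma>"
    and "\<forall>t\<in>{a..b}. \<gamma> t \<in> de_sitter_upper"
    and "\<forall>t\<in>{a..b}. sinh (u t) + \<Lambda> \<noteq> 0"
  shows "catenary_xy a b \<Lambda> u v \<longleftrightarrow>
    (\<forall>t\<in>{a..b}. curvature a b \<gamma> t =
       - (deriv_on a b v t * (cosh (u t))\<^sup>2 / ((sinh (u t) + \<Lambda>) * lspeed a b \<gamma> t)))"
proof -
  define \<epsilon> where "\<epsilon> = causal_sign a b \<gamma>"
  note linner = linner_deriv_on_\<Psi>[OF assms(1-3), folded assms(4)]
  \<comment> \<open>In both causal cases the causal sign makes the product with the squared velocity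
    positive.\<close>
  interpret nondegenerate_pair a b \<epsilon> \<Lambda> u v
  proof
    show "0 < \<epsilon> * ((deriv_on a b v t)\<^sup>2 * (cosh (u t))\<^sup>2 - (deriv_on a b u t)\<^sup>2)" if "t \<in> {a..b}" for t
      using assms(5) that
      by (auto simp: nondegenerate_curve_def \<epsilon>_def causal_sign_def spacelike_curve_def timelike_curve_def
          simp flip: linner)
  qed (use assms in \<open>auto simp: \<epsilon>_def causal_sign_def\<close>)
  have "curvature a b \<gamma> t = - (v' t * (cosh (u t))\<^sup>2 / ((sinh (u t) + \<Lambda>) * lspeed a b \<gamma> t))
          \<longleftrightarrow> euler_lagrange t = 0" if t: "t \<in> {a..b}" for t
  proof -
    define S where "S = sinh (u t) + \<Lambda>"
    let ?D = "curve_det t" and ?W = "speed t" and ?q = "v' t * (cosh (u t))\<^sup>2"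
    have W: "lspeed a b \<gamma> t = ?W"
      unfolding lspeed_def speed_def linner[OF t] \<epsilon>_def[symmetric] ..
    have \<kappa>: "curvature a b \<gamma> t = \<epsilon> * (?D / ?W ^ 3)"
      using det_\<Psi>[OF assms(1-3) t, folded assms(4)] fun_cong[OF assms(4), of t]
      by (simp add: curvature_eq_det W curve_det_def flip: \<epsilon>_def)
    have nz: "S \<noteq> 0" "?W \<noteq> 0" "cosh (u t) \<noteq> 0" "\<epsilon> \<noteq> 0"
      using assms(7) t speed_pos[OF t] eps by (auto simp: S_def)
    \<comment> \<open>Multiplication by \<open>S * ?W ^ 3\<close> clears the denominators; it is
      reversible since \<open>S\<close> and \<open>?W\<close> are nonzero.\<close>
    have "curvature a b \<gamma> t = - (?q / (S * ?W)) \<longleftrightarrow> \<epsilon> * S * ?D = - (?q * ?W\<^sup>2)"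
      unfolding \<kappa> using nz by (simp add: field_simps power2_eq_square power3_eq_cube)
    \<comment> \<open>Factoring out \<open>\<epsilon>\<close> exposes the bracket that equals
      \<open>euler_lagrange t\<close> up to the nonzero factor
      \<open>cosh (u t) / ?W ^ 3\<close>.\<close>
    also have "\<dots> \<longleftrightarrow> \<epsilon> * (\<epsilon> * ?q * ?W\<^sup>2 + S * ?D) = 0"
      using eps by algebra
    also have "\<dots> \<longleftrightarrow> euler_lagrange t = 0"
    proof -
      have "euler_lagrange t = cosh (u t) / ?W ^ 3 * (\<epsilon> * ?q * ?W\<^sup>2 + S * ?D)"
        unfolding euler_lagrange_def S_def[symmetric]
        using nz by (simp add: field_simps power2_eq_square power3_eq_cube)
      with nz show ?thesis by simp
    qed
    finally show ?thesis by (simp add: W S_def)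
  qed
  then show ?thesis
    using catenary_xy_iff[OF \<epsilon>_def[symmetric, unfolded assms(4)]] by simp
qed

end
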